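(* Let $\lambda,\kappa\in\mathbf{k}$ be fixed. (Left square.) Let $(A,\prec,\succ,\bullet)$ be an extended tridendriform algebra of weight $(\lambda,\kappa)$. (1) With $x\star y:=x\prec y+x\succ y+\lambda\, x\bullet y$, the pair $(A,\star)$ is an associative algebra. (2) With $[x,y]:=x\bullet y-y\bullet x$ and $x\circ y:=x\succ y-y\prec x$, the triple $(A,[\,,\,],\circ)$ is an extended post-Lie algebra of weight $(\lambda,\kappa)$. (3) For every extended post-Lie algebra $(B,[\,,\,],\circ)$ of weight $(\lambda,\kappa)$, the operation $\{x,y\}:=x\circ y-y\circ x+\lambda[x,y]$ is a Lie bracket on $B$. (4) The left square commutes: for the extended post-Lie algebra obtained from $(A,\prec,\succ,\bullet)$ in (2), the Lie bracket $\{\,,\,\}$ of (3) equals the commutator $[x,y]':=x\star y-y\star x$ of the associative product of (1). (Right square.) Let $(A,\prec',\succ')$ be an extended dendriform algebra. (5) With $x\star y:=x\succ' y+x\prec' y$, the pair $(A,\star)$ is an associative algebra. (6) With $x\triangleleft y:=x\prec' y$, $x\triangleright y:=x\succ' y$ and $x\circ y:=x\succ' y-y\prec' x$, the quadruple $(A,\triangleleft,\triangleright,\circ)$ is an extended pre-Lie algebra. (7) For every extended pre-Lie algebra $(B,\triangleleft,\triangleright,\circ)$, the operation $[x,y]:=x\circ y-y\circ x$ is a Lie bracket on $B$. (8) The right square commutes: for the extended pre-Lie algebra obtained from $(A,\prec',\succ')$ in (6), the Lie bracket of (7) equals the commutator $[x,y]':=x\star y-y\star x$ of the associative product of (5).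
   Context: $\mathbf{k}$ is a field of characteristic $0$; all algebras are nonunitary, vector spaces are over $\mathbf{k}$, and all operations are bilinear. An extended tridendriform algebra of weight $(\lambda,\kappa)$ is a vector space $A$ with three binary operations $\prec,\succ,\bullet$ such that, with $\star_\lambda:=\prec+\succ+\lambda\bullet$, for all $x,y,z\in A$: $(x\prec y)\prec z=x\prec(y\star_\lambda z)+\kappa\, x\bullet(y\bullet z)$; $(x\succ y)\prec z=x\succ(y\prec z)$; $(x\star_\lambda y)\succ z+\kappa\,(x\bullet y)\bullet z=x\succ(y\succ z)$; $(x\succ y)\bullet z=x\succ(y\bullet z)$; $(x\prec y)\bullet z=x\bullet(y\succ z)$; $(x\bullet y)\prec z=x\bullet(y\prec z)$; $(x\bullet y)\bullet z=x\bullet(y\bullet z)$. An extended dendriform algebra is a vector space $A$ with two binary operations $\prec,\succ$ such that, with $\star:=\prec+\succ$, for all $x,y,z\in A$: $(x\prec y)\prec z+(x\star y)\succ z=x\prec(y\star z)+x\succ(y\succ z)$ and $(x\succ y)\prec z=x\succ(y\prec z)$. An extended post-Lie algebra of weight $(\lambda,\kappa)$ is a vector space $A$ with binary operations $\circ$ and $[\,,\,]$, where $[\,,\,]$ is a Lie bracket, such that for all $x,y,z\in A$: $(x\circ y)\circ z-(y\circ x)\circ z+\lambda[x,y]\circ z+\kappa[[x,y],z]=x\circ(y\circ z)-y\circ(x\circ z)$ and $x\circ[y,z]=[x\circ y,z]+[y,x\circ z]$. An extended pre-Lie algebra is a vector space $A$ with three binary operations $\triangleleft,\triangleright,\circ$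 such that, with $\ast:=\triangleleft+\triangleright$, for all $x,y,z\in A$: $(x\triangleleft y)\triangleleft z-x\triangleleft(y\ast z)+(x\ast y)\triangleright z-x\triangleright(y\triangleright z)=(y\triangleleft x)\triangleleft z-y\triangleleft(x\ast z)+(y\ast x)\triangleright z-y\triangleright(x\triangleright z)$, and $(x\circ y)\circ z-x\circ(y\circ z)+(x\triangleleft y)\triangleleft z-x\triangleleft(y\ast z)+z\triangleright(y\triangleright x)-(z\ast y)\triangleright x=(y\circ x)\circ z-y\circ(x\circ z)+(y\triangleleft x)\triangleleft z-y\triangleleft(x\ast z)+z\triangleright(x\triangleright y)-(z\ast x)\triangleright y$. *)

theory Defs
  imports Complex_Main
begin

text \<open>
  Vector spaces are whole types with an explicit scalar multiplication, as in
  \<^locale>\<open>vector_space\<close>. The library's \<open>bilinear\<close> is restricted to real vector spaces,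
  so bilinearity is stated here over an arbitrary field.
\<close>

definition bilinear_op ::
    "('k::field \<Rightarrow> 'a::ab_group_add \<Rightarrow> 'a) \<Rightarrow> ('a \<Rightarrow> 'a \<Rightarrow> 'a) \<Rightarrow> bool" where
  "bilinear_op scale m \<longleftrightarrow>
     (\<forall>x. Vector_Spaces.linear scale scale (\<lambda>y. m x y)) \<and>
     (\<forall>y. Vector_Spaces.linear scale scale (\<lambda>x. m x y))"

definition commutator :: "('a::ab_group_add \<Rightarrow> 'a \<Rightarrow> 'a) \<Rightarrow> 'a \<Rightarrow> 'a \<Rightarrow> 'a" where
  "commutator m x y = m x y - m y x"

definition sum_op :: "('a::ab_group_add \<Rightarrow> 'a \<Rightarrow> 'a) \<Rightarrow> ('a \<Rightarrow> 'a \<Rightarrow> 'a) \<Rightarrow> 'a \<Rightarrow> 'a \<Rightarrow> 'a" where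
  "sum_op f g x y = f x y + g x y"

definition weighted_sum_op ::
    "('k \<Rightarrow> 'a::ab_group_add \<Rightarrow> 'a) \<Rightarrow> ('a \<Rightarrow> 'a \<Rightarrow> 'a) \<Rightarrow> ('a \<Rightarrow> 'a \<Rightarrow> 'a) \<Rightarrow>
      ('a \<Rightarrow> 'a \<Rightarrow> 'a) \<Rightarrow> 'k \<Rightarrow> 'a \<Rightarrow> 'a \<Rightarrow> 'a" where
  "weighted_sum_op scale prec succ bullet lambda x y =
     prec x y + succ x y + scale lambda (bullet x y)"

definition succ_minus_prec_op ::
    "('a::ab_group_add \<Rightarrow> 'a \<Rightarrow> 'a) \<Rightarrow> ('a \<Rightarrow> 'a \<Rightarrow> 'a) \<Rightarrow> 'a \<Rightarrow> 'a \<Rightarrow> 'a" where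
  "succ_minus_prec_op prec succ x y = succ x y - prec y x"

definition post_Lie_bracket ::
    "('k \<Rightarrow> 'a::ab_group_add \<Rightarrow> 'a) \<Rightarrow> ('a \<Rightarrow> 'a \<Rightarrow> 'a) \<Rightarrow> ('a \<Rightarrow> 'a \<Rightarrow> 'a) \<Rightarrow> 'k \<Rightarrow>
      'a \<Rightarrow> 'a \<Rightarrow> 'a" where
  "post_Lie_bracket scale br circ lambda x y =
     circ x y - circ y x + scale lambda (br x y)"

locale associative_algebra = vector_space scale
  for scale :: "'k::field \<Rightarrow> 'a::ab_group_add \<Rightarrow> 'a" +
  fixes mul :: "'a \<Rightarrow> 'a \<Rightarrow> 'a"
  assumes bilinear_mul: "bilinear_op scale mul"
    and assoc: "mul (mul x y) z = mul x (mul y z)"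

locale lie_algebra = vector_space scale
  for scale :: "'k::field \<Rightarrow> 'a::ab_group_add \<Rightarrow> 'a" +
  fixes br :: "'a \<Rightarrow> 'a \<Rightarrow> 'a"
  assumes bilinear_br: "bilinear_op scale br"
    and alternating: "br x x = 0"
    and jacobi: "br (br x y) z + br (br y z) x + br (br z x) y = 0"

locale extended_tridendriform = vector_space scale
  for scale :: "'k::field \<Rightarrow> 'a::ab_group_add \<Rightarrow> 'a" (infixr \<open>*s\<close> 75) +
  fixes prec :: "'a \<Rightarrow> 'a \<Rightarrow> 'a" (infix \<open>\<prec>\<close> 70)
    and succ :: "'a \<Rightarrow> 'a \<Rightarrow> 'a" (infix \<open>\<succ>\<close> 70)
    and bullet :: "'a \<Rightarrow> 'a \<Rightarrow> 'a" (infix \<open>\<bullet>\<close> 70)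
    and lambda kappa :: 'k
  fixes star :: "'a \<Rightarrow> 'a \<Rightarrow> 'a" (infix \<open>\<star>\<close> 70)
  defines "star \<equiv> weighted_sum_op scale prec succ bullet lambda"
  assumes bilinear_prec: "bilinear_op scale prec"
    and bilinear_succ: "bilinear_op scale succ"
    and bilinear_bullet: "bilinear_op scale bullet"
    and prec_prec: "(x \<prec> y) \<prec> z = x \<prec> (y \<star> z) + kappa *s (x \<bullet> (y \<bullet> z))"
    and succ_prec: "(x \<succ> y) \<prec> z = x \<succ> (y \<prec> z)"
    and succ_succ: "(x \<star> y) \<succ> z + kappa *s ((x \<bullet> y) \<bullet> z) = x \<succ> (y \<succ> z)"
    and succ_bullet: "(x \<succ> y) \<bullet> z = x \<succ> (y \<bullet> z)"
    and prec_bullet: "(x \<prec> y) \<bullet> z = x \<bullet> (y \<succ> z)"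
    and bullet_prec: "(x \<bullet> y) \<prec> z = x \<bullet> (y \<prec> z)"
    and bullet_bullet: "(x \<bullet> y) \<bullet> z = x \<bullet> (y \<bullet> z)"

locale extended_dendriform = vector_space scale
  for scale :: "'k::field \<Rightarrow> 'a::ab_group_add \<Rightarrow> 'a" +
  fixes prec :: "'a \<Rightarrow> 'a \<Rightarrow> 'a" (infix \<open>\<prec>\<close> 70)
    and succ :: "'a \<Rightarrow> 'a \<Rightarrow> 'a" (infix \<open>\<succ>\<close> 70)
  fixes star :: "'a \<Rightarrow> 'a \<Rightarrow> 'a" (infix \<open>\<star>\<close> 70)
  defines "star \<equiv> sum_op prec succ"
  assumes bilinear_prec: "bilinear_op scale prec"
    and bilinear_succ: "bilinear_op scale succ"
    and prec_succ: "(x \<prec> y) \<prec> z + (x \<star> y) \<succ> z = x \<prec> (y \<star> z) + x \<succ> (y \<succ> z)"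
    and succ_prec: "(x \<succ> y) \<prec> z = x \<succ> (y \<prec> z)"

locale extended_post_Lie = lie_algebra scale br
  for scale :: "'k::field \<Rightarrow> 'a::ab_group_add \<Rightarrow> 'a" (infixr \<open>*s\<close> 75)
    and br :: "'a \<Rightarrow> 'a \<Rightarrow> 'a" +
  fixes circ :: "'a \<Rightarrow> 'a \<Rightarrow> 'a" (infix \<open>\<odot>\<close> 70)
    and lambda kappa :: 'k
  assumes bilinear_circ: "bilinear_op scale circ"
    and circ_circ:
      "(x \<odot> y) \<odot> z - (y \<odot> x) \<odot> z + lambda *s (br x y \<odot> z) + kappa *s br (br x y) z
       = x \<odot> (y \<odot> z) - y \<odot> (x \<odot> z)"
    and circ_br: "x \<odot> br y z = br (x \<odot> y) z + br y (x \<odot> z)"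

locale extended_pre_Lie = vector_space scale
  for scale :: "'k::field \<Rightarrow> 'a::ab_group_add \<Rightarrow> 'a" +
  fixes lact :: "'a \<Rightarrow> 'a \<Rightarrow> 'a" (infix \<open>\<lhd>\<close> 70)
    and ract :: "'a \<Rightarrow> 'a \<Rightarrow> 'a" (infix \<open>\<rhd>\<close> 70)
    and circ :: "'a \<Rightarrow> 'a \<Rightarrow> 'a" (infix \<open>\<odot>\<close> 70)
  fixes ast :: "'a \<Rightarrow> 'a \<Rightarrow> 'a" (infix \<open>\<ast>\<close> 70)
  defines "ast \<equiv> sum_op lact ract"
  assumes bilinear_lact: "bilinear_op scale lact"
    and bilinear_ract: "bilinear_op scale ract"
    and bilinear_circ: "bilinear_op scale circ"
    and lact_ract:
      "(x \<lhd> y) \<lhd> z - x \<lhd> (y \<ast> z) + (x \<ast> y) \<rhd> z - x \<rhd> (y \<rhd> z)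
       = (y \<lhd> x) \<lhd> z - y \<lhd> (x \<ast> z) + (y \<ast> x) \<rhd> z - y \<rhd> (x \<rhd> z)"
    and circ_circ:
      "(x \<odot> y) \<odot> z - x \<odot> (y \<odot> z) + (x \<lhd> y) \<lhd> z - x \<lhd> (y \<ast> z)
         + z \<rhd> (y \<rhd> x) - (z \<ast> y) \<rhd> x
       = (y \<odot> x) \<odot> z - y \<odot> (x \<odot> z) + (y \<lhd> x) \<lhd> z - y \<lhd> (x \<ast> z)
         + z \<rhd> (x \<rhd> y) - (z \<ast> x) \<rhd> y"

end

theory Submission
  imports Defs
begin

text \<open>
  Everything rests on two observations about alternating sums.

  A bilinear product \<open>m\<close> need not be associative for its commutator to satisfy the Jacobi
  identity: expanding the nested commutators leaves exactly the alternating sum, over all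
  permutations of \<open>x, y, z\<close>, of the associator
  \<open>m (m x y) z - m x (m y z)\<close> (\<open>lie_algebra_commutatorI\<close>). Associative products trivially
  have vanishing associator. In an extended pre-Lie algebra write
  \<open>P x y z = (x \<lhd> y) \<lhd> z - x \<lhd> (y \<ast> z)\<close> and
  \<open>Q x y z = x \<rhd> (y \<rhd> z) - (x \<ast> y) \<rhd> z\<close>. The second axiom replaces the associator in the
  alternating sum by \<open>- P x y z - Q z y x\<close>; since reversing three letters is an odd
  permutation, the sum becomes that of \<open>Q - P\<close>, which vanishes because the first axiom says that
  \<open>P - Q\<close> is symmetric in its first two arguments. For an extended dendriform algebra one even
  has \<open>P = Q\<close>; together with \<open>(x \<succ> y) \<prec> z = x \<succ> (y \<prec> z)\<close> this gives both pre-Lie axioms and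
  the associativity of \<open>\<prec> + \<succ>\<close>.

  In an extended post-Lie algebra the first axiom says that the bracket
  \<open>{x, y} = x \<odot> y - y \<odot> x + \<lambda> [x, y]\<close> acts by the commutator of the left
  multiplications, up to the error \<open>\<kappa> [[x, y], z]\<close>. In the Jacobi sum of \<open>{,}\<close> these errors
  cancel by the Jacobi identity of \<open>[,]\<close>, as do the terms in \<open>\<lambda>\<^sup>2\<close>, and the remaining mixed terms cancel because left
  multiplications are derivations of \<open>[,]\<close>. For an extended tridendriform algebra the two
  \<open>\<kappa>\<close>-corrections in the axioms for \<open>\<prec>\<close> and \<open>\<succ>\<close> are the two bracketings of a product in the
  associative algebra given by \<open>\<bullet>\<close>. They cancel in the associator of \<open>\<star>\<close>, while
  antisymmetrised in the first axiom for \<open>x \<succ> y - y \<prec> x\<close> they produce precisely the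
  \<open>\<kappa>\<close>-term of the post-Lie identity. Both squares commute since
  \<open>(x \<succ> y - y \<prec> x) - (y \<succ> x - x \<prec> y)\<close> is the commutator of \<open>\<prec> + \<succ>\<close>.
\<close>

section \<open>Bilinear operations\<close>

lemma bilinear_op_iff:
  "bilinear_op scale m \<longleftrightarrow> vector_space scale \<and>
     (\<forall>x y z. m (x + y) z = m x z + m y z) \<and> (\<forall>x y z. m x (y + z) = m x y + m x z) \<and>
     (\<forall>c x y. m (scale c x) y = scale c (m x y)) \<and> (\<forall>c x y. m x (scale c y) = scale c (m x y))"
  unfolding bilinear_op_def Vector_Spaces.linear_iff by metis

lemma bilinear_op_diff:
  assumes "bilinear_op scale m"
  shows "m (x - y) z = m x z - m y z" "m x (y - z) = m x y - m x z"
proof -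
  have "additive (\<lambda>x. m x z)" "additive (m x)"
    using assms by (auto simp: bilinear_op_iff additive_def)
  then show "m (x - y) z = m x z - m y z" "m x (y - z) = m x y - m x z"
    by (auto dest: additive.diff)
qed

lemma bilinear_op_expand:
  assumes "bilinear_op scale m"
  shows "m (x + y) z = m x z + m y z" "m x (y + z) = m x y + m x z"
    "m (x - y) z = m x z - m y z" "m x (y - z) = m x y - m x z"
    "m (scale c x) y = scale c (m x y)" "m x (scale c y) = scale c (m x y)"
  using assms bilinear_op_diff[OF assms] by (simp_all add: bilinear_op_iff)

lemma bilinear_op_sum_op:
  assumes "bilinear_op scale f" "bilinear_op scale g"
  shows "bilinear_op scale (sum_op f g)"
proof -
  interpret vector_space scale using assms by (simp add: bilinear_op_iff)
  show ?thesis
    using assms by (simp add: bilinear_op_iff sum_op_def algebra_simps)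
qed

lemma bilinear_op_succ_minus_prec_op:
  assumes "bilinear_op scale f" "bilinear_op scale g"
  shows "bilinear_op scale (succ_minus_prec_op f g)"
proof -
  interpret vector_space scale using assms by (simp add: bilinear_op_iff)
  show ?thesis
    using assms by (simp add: bilinear_op_iff succ_minus_prec_op_def algebra_simps)
qed

lemma bilinear_op_scale:
  assumes "bilinear_op scale m"
  shows "bilinear_op scale (\<lambda>x y. scale c (m x y))"
proof -
  interpret vector_space scale using assms by (simp add: bilinear_op_iff)
  show ?thesis
    using assms by (simp add: bilinear_op_iff algebra_simps)
qed

lemma commutator_eq_succ_minus_prec_op: "commutator m = succ_minus_prec_op m m"
  by (simp add: fun_eq_iff commutator_def succ_minus_prec_op_def)

lemma bilinear_op_commutator:
  "bilinear_op scale m \<Longrightarrow> bilinear_op scale (commutator m)"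
  by (simp add: commutator_eq_succ_minus_prec_op bilinear_op_succ_minus_prec_op)

lemma bilinear_op_weighted_sum_op:
  assumes "bilinear_op scale f" "bilinear_op scale g" "bilinear_op scale h"
  shows "bilinear_op scale (weighted_sum_op scale f g h c)"
proof -
  have "weighted_sum_op scale f g h c = sum_op (sum_op f g) (\<lambda>x y. scale c (h x y))"
    by (simp add: fun_eq_iff weighted_sum_op_def sum_op_def)
  then show ?thesis
    using assms by (simp add: bilinear_op_sum_op bilinear_op_scale)
qed

lemma bilinear_op_post_Lie_bracket:
  assumes "bilinear_op scale br" "bilinear_op scale circ"
  shows "bilinear_op scale (post_Lie_bracket scale br circ c)"
proof -
  have "post_Lie_bracket scale br circ c = sum_op (commutator circ) (\<lambda>x y. scale c (br x y))"
    by (simp add: fun_eq_iff post_Lie_bracket_def sum_op_def commutator_def)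
  then show ?thesis
    using assms by (simp add: bilinear_op_sum_op bilinear_op_scale bilinear_op_commutator)
qed

section \<open>Lie-admissible products\<close>

text \<open>
  The hypothesis \<open>admissible\<close> is the vanishing of the alternating sum of associators; grouped
  by cyclic rotations, it is a condition on the antisymmetrisation of the associator in its
  first two arguments, which is what pre-Lie type axioms control.
\<close>

lemma lie_algebra_commutatorI:
  fixes m :: "'a::ab_group_add \<Rightarrow> 'a \<Rightarrow> 'a" and a :: "'a \<Rightarrow> 'a \<Rightarrow> 'a \<Rightarrow> 'a"
  defines "a \<equiv> \<lambda>x y z. m (m x y) z - m x (m y z)"
  assumes bil: "bilinear_op scale m"
    and admissible: "\<And>x y z. (a x y z - a y x z) + (a y z x - a z y x) + (a z x y - a x z y) = 0"
  shows "lie_algebra scale (commutator m)"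
proof -
  interpret vector_space scale using bil by (simp add: bilinear_op_iff)
  show ?thesis
  proof unfold_locales
    fix x y z
    have "commutator m (commutator m x y) z + commutator m (commutator m y z) x
        + commutator m (commutator m z x) y
        = (a x y z - a y x z) + (a y z x - a z y x) + (a z x y - a x z y)"
      unfolding a_def commutator_def bilinear_op_expand[OF bil] by (simp add: algebra_simps)
    then show "commutator m (commutator m x y) z + commutator m (commutator m y z) x
        + commutator m (commutator m z x) y = 0"
      by (simp only: admissible)
  qed (simp_all add: bilinear_op_commutator bil, simp add: commutator_def)
qed

section \<open>Post-Lie algebras\<close>

text \<open>
  Each nested bracket is expanded by treating its two halves differently: the inner bracket acting
  on \<open>z\<close> is rewritten by the first post-Lie axiom, while \<open>z\<close> acting on the inner bracket uses that
  \<open>\<odot>\<close> acts by derivations of \<open>br\<close>.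
\<close>

lemma (in extended_post_Lie) lie_algebra_post_Lie_bracket:
  "lie_algebra scale (post_Lie_bracket scale br circ lambda)"
proof unfold_locales
  let ?B = "post_Lie_bracket scale br circ lambda"
  note expand = bilinear_op_expand[OF bilinear_br] bilinear_op_expand[OF bilinear_circ]
  have anti: "br x y = - br y x" for x y
  proof -
    have "br (x + y) (x + y) = br x x + br y y + (br x y + br y x)"
      by (simp add: expand algebra_simps)
    then show ?thesis by (simp add: alternating eq_neg_iff_add_eq_0)
  qed
  show "bilinear_op scale ?B"
    by (rule bilinear_op_post_Lie_bracket[OF bilinear_br bilinear_circ])
  fix x y z
  show "?B x x = 0"
    by (simp add: post_Lie_bracket_def alternating)
  have action: "?B x y \<odot> z = x \<odot> (y \<odot> z) - y \<odot> (x \<odot> z) - kappa *s br (br x y) z" for x y z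
    using circ_circ[of x y z] by (simp add: post_Lie_bracket_def expand algebra_simps)
  \<comment> \<open>Under cyclic rotation the four \<open>\<odot>\<close>-terms cancel in pairs, and so do the four terms with
    factor \<open>lambda\<close>; only the Jacobi sum of \<open>br\<close> is left.\<close>
  have nested: "?B (?B x y) z
      = x \<odot> (y \<odot> z) - y \<odot> (x \<odot> z) - z \<odot> (x \<odot> y) + z \<odot> (y \<odot> x)
        + lambda *s (br (x \<odot> y) z - br (y \<odot> x) z - br (z \<odot> x) y + br (z \<odot> y) x)
        + (lambda * lambda - kappa) *s br (br x y) z" for x y z
  proof -
    have "?B (?B x y) z = ?B x y \<odot> z - z \<odot> ?B x y + lambda *s br (?B x y) z"
      by (simp add: post_Lie_bracket_def)
    moreover have "z \<odot> ?B x y = z \<odot> (x \<odot> y) - z \<odot> (y \<odot> x)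
        + lambda *s (br (z \<odot> x) y - br (z \<odot> y) x)"
      using anti[of x "z \<odot> y"] by (simp add: post_Lie_bracket_def expand circ_br)
    moreover have "br (?B x y) z = br (x \<odot> y) z - br (y \<odot> x) z + lambda *s br (br x y) z"
      by (simp add: post_Lie_bracket_def expand)
    ultimately show ?thesis
      by (simp add: action algebra_simps)
  qed
  have "?B (?B x y) z + ?B (?B y z) x + ?B (?B z x) y
      = (lambda * lambda - kappa) *s (br (br x y) z + br (br y z) x + br (br z x) y)"
    unfolding nested by (simp add: algebra_simps)
  then show "?B (?B x y) z + ?B (?B y z) x + ?B (?B z x) y = 0"
    by (simp only: jacobi scale_zero_right)
qed

section \<open>Tridendriform algebras\<close>

context extended_tridendriform
begin

lemmas expand = bilinear_op_expand[OF bilinear_prec] bilinear_op_expand[OF bilinear_succ]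
  bilinear_op_expand[OF bilinear_bullet]

lemma star_eq: "x \<star> y = x \<prec> y + x \<succ> y + lambda *s (x \<bullet> y)"
  by (simp add: star_def weighted_sum_op_def)

text \<open>
  Replacing every term of \<open>(x \<star> y) \<star> z\<close> by the axiom for it creates
  \<open>kappa *s (x \<bullet> (y \<bullet> z))\<close> from \<open>\<prec>\<close> and \<open>- kappa *s ((x \<bullet> y) \<bullet> z)\<close> from \<open>\<succ>\<close>, which
  cancel because \<open>\<bullet>\<close> is associative.
\<close>

lemma associative_algebra_star: "associative_algebra scale (\<star>)"
proof unfold_locales
  show "bilinear_op scale (\<star>)"
    unfolding star_def
    by (rule bilinear_op_weighted_sum_op[OF bilinear_prec bilinear_succ bilinear_bullet])
  fix x y z
  have "(x \<star> y) \<star> z = (x \<prec> y) \<prec> z + (x \<succ> y) \<prec> z + lambda *s ((x \<bullet> y) \<prec> z) + (x \<star> y) \<succ> z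
      + lambda *s ((x \<prec> y) \<bullet> z + (x \<succ> y) \<bullet> z + lambda *s ((x \<bullet> y) \<bullet> z))"
    unfolding star_eq[of "x \<star> y" z] by (simp add: star_eq expand)
  also have "\<dots> = x \<prec> (y \<star> z) + x \<succ> (y \<prec> z) + lambda *s (x \<bullet> (y \<prec> z)) + x \<succ> (y \<succ> z)
      + lambda *s (x \<bullet> (y \<succ> z) + x \<succ> (y \<bullet> z) + lambda *s (x \<bullet> (y \<bullet> z)))"
    unfolding prec_prec succ_prec bullet_prec succ_succ[symmetric]
    by (simp add: prec_bullet succ_bullet bullet_bullet algebra_simps)
  also have "\<dots> = x \<star> (y \<star> z)"
    unfolding star_eq[of x "y \<star> z"] by (simp add: star_eq expand algebra_simps)
  finally show "(x \<star> y) \<star> z = x \<star> (y \<star> z)" .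
qed

lemma post_Lie_bracket_eq_commutator_star:
  "post_Lie_bracket scale (commutator (\<bullet>)) (succ_minus_prec_op (\<prec>) (\<succ>)) lambda = commutator (\<star>)"
  by (simp add: fun_eq_iff post_Lie_bracket_def commutator_def succ_minus_prec_op_def star_eq
      algebra_simps)

text \<open>
  The first three terms of the post-Lie identity combine to the action of the commutator of
  \<open>\<star>\<close> on \<open>z\<close>, and \<open>x \<star> y\<close> occurs on the left of \<open>\<succ>\<close> and on the right of \<open>\<prec>\<close> exactly as in the
  tridendriform axioms. The four \<open>kappa\<close>-terms so produced are the expansion of
  \<open>- kappa *s [[x, y], z]\<close> in the associative algebra with product \<open>\<bullet>\<close>.
\<close>

lemma extended_post_Lie_commutator:
  "extended_post_Lie scale (commutator (\<bullet>)) (succ_minus_prec_op (\<prec>) (\<succ>)) lambda kappa"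
proof -
  let ?b = "commutator (\<bullet>)" and ?c = "succ_minus_prec_op (\<prec>) (\<succ>)"
  have bil_c: "bilinear_op scale ?c"
    by (rule bilinear_op_succ_minus_prec_op[OF bilinear_prec bilinear_succ])
  interpret lie_algebra scale ?b
    by (rule lie_algebra_commutatorI[OF bilinear_bullet]) (simp add: bullet_bullet)
  show ?thesis
  proof unfold_locales
    show "bilinear_op scale ?c" by (fact bil_c)
    fix x y z
    have "?c (?c x y) z - ?c (?c y x) z + lambda *s ?c (?b x y) z
        = ?c (post_Lie_bracket scale ?b ?c lambda x y) z"
      by (simp add: post_Lie_bracket_def bilinear_op_expand[OF bil_c])
    also have "\<dots> = ?c (commutator (\<star>) x y) z"
      by (simp only: post_Lie_bracket_eq_commutator_star)
    also have "\<dots> = ((x \<star> y) \<succ> z - (y \<star> x) \<succ> z) - (z \<prec> (x \<star> y) - z \<prec> (y \<star> x))"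
      by (simp add: succ_minus_prec_op_def commutator_def expand)
    also have "\<dots> = x \<succ> (y \<succ> z) - y \<succ> (x \<succ> z) - (z \<prec> x) \<prec> y + (z \<prec> y) \<prec> x
        - kappa *s ?b (?b x y) z"
      unfolding prec_prec succ_succ[symmetric]
      by (simp add: commutator_def expand bullet_bullet algebra_simps)
    also have "\<dots> = ?c x (?c y z) - ?c y (?c x z) - kappa *s ?b (?b x y) z"
      by (simp add: succ_minus_prec_op_def expand succ_prec)
    finally show "?c (?c x y) z - ?c (?c y x) z + lambda *s ?c (?b x y) z + kappa *s ?b (?b x y) z
        = ?c x (?c y z) - ?c y (?c x z)"
      by simp
    show "?c x (?b y z) = ?b (?c x y) z + ?b y (?c x z)"
      by (simp add: succ_minus_prec_op_def commutator_def expand prec_bullet bullet_prec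
          succ_bullet)
  qed
qed

end

section \<open>Dendriform and pre-Lie algebras\<close>

context extended_dendriform
begin

lemmas expand = bilinear_op_expand[OF bilinear_prec] bilinear_op_expand[OF bilinear_succ]

lemma star_eq: "x \<star> y = x \<prec> y + x \<succ> y"
  by (simp add: star_def sum_op_def)

lemma associative_algebra_star: "associative_algebra scale (\<star>)"
proof unfold_locales
  show "bilinear_op scale (\<star>)"
    unfolding star_def by (rule bilinear_op_sum_op[OF bilinear_prec bilinear_succ])
  fix x y z
  have "(x \<star> y) \<star> z = ((x \<prec> y) \<prec> z + (x \<star> y) \<succ> z) + (x \<succ> y) \<prec> z"
    unfolding star_eq[of "x \<star> y" z] by (simp add: star_eq expand)
  also have "\<dots> = x \<prec> (y \<star> z) + x \<succ> (y \<succ> z) + x \<succ> (y \<prec> z)"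
    by (simp only: prec_succ succ_prec)
  also have "\<dots> = x \<star> (y \<star> z)"
    unfolding star_eq[of x "y \<star> z"] by (simp add: star_eq expand)
  finally show "(x \<star> y) \<star> z = x \<star> (y \<star> z)" .
qed

lemma extended_pre_Lie_succ_minus_prec:
  "extended_pre_Lie scale (\<prec>) (\<succ>) (succ_minus_prec_op (\<prec>) (\<succ>))"
proof -
  let ?c = "succ_minus_prec_op (\<prec>) (\<succ>)"
  define P where "P x y z = (x \<prec> y) \<prec> z - x \<prec> (y \<star> z)" for x y z
  define Q where "Q x y z = x \<succ> (y \<succ> z) - (x \<star> y) \<succ> z" for x y z
  have PQ: "P x y z = Q x y z" for x y z
    using prec_succ[of x y z] by (simp add: P_def Q_def algebra_simps)
  \<comment> \<open>The terms \<open>x \<succ> (z \<prec> y) + (y \<succ> z) \<prec> x\<close> of the associator of \<open>?c\<close> drop out: by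
    \<open>succ_prec\<close> they are symmetric in \<open>x\<close> and \<open>y\<close>.\<close>
  have assoc: "(?c (?c x y) z - ?c x (?c y z)) - (?c (?c y x) z - ?c y (?c x z))
      = P z x y - P z y x - Q x y z + Q y x z" for x y z
    by (simp add: P_def Q_def succ_minus_prec_op_def star_eq expand succ_prec algebra_simps)
  show ?thesis
  proof (unfold_locales, fold star_def)
    show "bilinear_op scale (\<prec>)" by (fact bilinear_prec)
    show "bilinear_op scale (\<succ>)" by (fact bilinear_succ)
    show "bilinear_op scale ?c"
      by (rule bilinear_op_succ_minus_prec_op[OF bilinear_prec bilinear_succ])
    fix x y z
    show "(x \<prec> y) \<prec> z - x \<prec> (y \<star> z) + (x \<star> y) \<succ> z - x \<succ> (y \<succ> z)
        = (y \<prec> x) \<prec> z - y \<prec> (x \<star> z) + (y \<star> x) \<succ> z - y \<succ> (x \<succ> z)"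
      using PQ[of x y z] PQ[of y x z] by (simp add: P_def Q_def algebra_simps)
    have "(?c (?c x y) z - ?c x (?c y z)) + P x y z + Q z y x
        = (?c (?c y x) z - ?c y (?c x z)) + P y x z + Q z x y"
      using assoc[of x y z] by (simp add: PQ algebra_simps)
    then show "?c (?c x y) z - ?c x (?c y z) + (x \<prec> y) \<prec> z - x \<prec> (y \<star> z)
          + z \<succ> (y \<succ> x) - (z \<star> y) \<succ> x
        = ?c (?c y x) z - ?c y (?c x z) + (y \<prec> x) \<prec> z - y \<prec> (x \<star> z)
          + z \<succ> (x \<succ> y) - (z \<star> x) \<succ> y"
      unfolding P_def Q_def by (simp only: add_diff_eq)
  qed
qed

lemma commutator_succ_minus_prec_op:
  "commutator (succ_minus_prec_op (\<prec>) (\<succ>)) = commutator (\<star>)"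
  by (simp add: fun_eq_iff commutator_def succ_minus_prec_op_def star_eq)

end

text \<open>
  \<open>a_swap\<close> trades associators for \<open>P\<close> and \<open>Q\<close>. In the cyclic sum the terms can be regrouped into
  differences of \<open>P - Q\<close> under exchange of its first two arguments, since \<open>Q z y x\<close> has the opposite
  sign in the alternating sum to \<open>Q x y z\<close>.
\<close>

lemma (in extended_pre_Lie) lie_algebra_commutator_circ:
  "lie_algebra scale (commutator circ)"
proof (rule lie_algebra_commutatorI[OF bilinear_circ])
  fix x y z
  define P where "P x y z = (x \<lhd> y) \<lhd> z - x \<lhd> (y \<ast> z)" for x y z
  define Q where "Q x y z = x \<rhd> (y \<rhd> z) - (x \<ast> y) \<rhd> z" for x y z
  define a where "a x y z = (x \<odot> y) \<odot> z - x \<odot> (y \<odot> z)" for x y z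
  have PQ: "P x y z - Q x y z = P y x z - Q y x z" for x y z
    using lact_ract[of x y z] by (simp add: P_def Q_def algebra_simps)
  have a_swap: "a x y z - a y x z = P y x z - P x y z + Q z x y - Q z y x" for x y z
    using circ_circ[of x y z] by (simp add: P_def Q_def a_def algebra_simps)
  have "(a x y z - a y x z) + (a y z x - a z y x) + (a z x y - a x z y)
      = ((P y x z - Q y x z) - (P x y z - Q x y z))
        + ((P z y x - Q z y x) - (P y z x - Q y z x))
        + ((P x z y - Q x z y) - (P z x y - Q z x y))"
    unfolding a_swap by (simp add: algebra_simps)
  also have "\<dots> = 0"
    by (simp add: PQ[of x y z] PQ[of y z x] PQ[of z x y])
  finally show "((x \<odot> y) \<odot> z - x \<odot> (y \<odot> z) - ((y \<odot> x) \<odot> z - y \<odot> (x \<odot> z)))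
      + ((y \<odot> z) \<odot> x - y \<odot> (z \<odot> x) - ((z \<odot> y) \<odot> x - z \<odot> (y \<odot> x)))
      + ((z \<odot> x) \<odot> y - z \<odot> (x \<odot> y) - ((x \<odot> z) \<odot> y - x \<odot> (z \<odot> y))) = 0"
    by (simp only: a_def)
qed

section \<open>The two commuting squares\<close>

theorem theorem2p26:
  fixes lambda kappa :: "'k::field_char_0"
  shows
    "(\<forall>(scale :: 'k \<Rightarrow> 'a::ab_group_add \<Rightarrow> 'a) prec succ bullet.
        extended_tridendriform scale prec succ bullet lambda kappa \<longrightarrow>
          associative_algebra scale (weighted_sum_op scale prec succ bullet lambda) \<and>
          extended_post_Lie scale (commutator bullet) (succ_minus_prec_op prec succ) lambda kappa \<and>
          post_Lie_bracket scale (commutator bullet) (succ_minus_prec_op prec succ) lambda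
            = commutator (weighted_sum_op scale prec succ bullet lambda)) \<and>
     (\<forall>(scale :: 'k \<Rightarrow> 'b::ab_group_add \<Rightarrow> 'b) br circ.
        extended_post_Lie scale br circ lambda kappa \<longrightarrow>
          lie_algebra scale (post_Lie_bracket scale br circ lambda)) \<and>
     (\<forall>(scale :: 'k \<Rightarrow> 'c::ab_group_add \<Rightarrow> 'c) prec succ.
        extended_dendriform scale prec succ \<longrightarrow>
          associative_algebra scale (sum_op succ prec) \<and>
          extended_pre_Lie scale prec succ (succ_minus_prec_op prec succ) \<and>
          commutator (succ_minus_prec_op prec succ) = commutator (sum_op succ prec)) \<and>
     (\<forall>(scale :: 'k \<Rightarrow> 'd::ab_group_add \<Rightarrow> 'd) lact ract circ.
        extended_pre_Lie scale lact ract circ \<longrightarrow>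
          lie_algebra scale (commutator circ))"
proof -
  have sum_op_commute: "sum_op succ prec = sum_op prec succ" for prec succ :: "'c \<Rightarrow> 'c \<Rightarrow> 'c"
    by (simp add: fun_eq_iff sum_op_def add.commute)
  show ?thesis
    by (auto simp: sum_op_commute
        intro: extended_tridendriform.associative_algebra_star
          extended_tridendriform.extended_post_Lie_commutator
          extended_tridendriform.post_Lie_bracket_eq_commutator_star
          extended_post_Lie.lie_algebra_post_Lie_bracket
          extended_dendriform.associative_algebra_star
          extended_dendriform.extended_pre_Lie_succ_minus_prec
          extended_dendriform.commutator_succ_minus_prec_op
          extended_pre_Lie.lie_algebra_commutator_circ)
qed

end
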